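(* Saturated $2$-dichromatic oriented graphs do not exist. That is, there is no oriented graph $D$ that is not a tournament, is $2$-dichromatic, and has the property that for every ordered pair $(u,v)$ of distinct non-adjacent vertices of $D$, the oriented graph obtained from $D$ by adding the arc from $u$ to $v$ is not $2$-dichromatic.
   Context: All digraphs are finite. An oriented graph is a digraph without loops, without parallel arcs and without directed $2$-cycles. A $k$-coloring of a digraph $D$ is a mapping from the vertices of $D$ to $\{1,\dots,k\}$ such that each color class induces an acyclic digraph (no directed cycle). A digraph is called $2$-dichromatic if it admits a $2$-coloring, i.e. its dichromatic number (the minimum $k$ such that it admits a $k$-coloring) is at most $2$. An oriented graph $D$ is saturated in a class $\mathcal{C}$ of oriented graphs if $D$ belongs to $\mathcal{C}$, but adding any arc to $D$ (so that the result is again an oriented graph) gives an oriented graph not belonging to $\mathcal{C}$. Tournaments are excluded from consideration as saturated oriented graphs, since no arcs can be added to them. Here $\mathcal{C}$ is the class of $2$-dichromatic oriented graphs. Two vertices are non-adjacent if there is no arc between them in either direction. *)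

theory Defs
  imports "Graph_Theory.Graph_Theory"
begin

locale oriented_graph = digraph +
  assumes no_digons: "u \<rightarrow>\<^bsub>G\<^esub> v \<Longrightarrow> \<not> v \<rightarrow>\<^bsub>G\<^esub> u"

definition adjacent :: "('a, 'b) pre_digraph \<Rightarrow> 'a \<Rightarrow> 'a \<Rightarrow> bool" where
  "adjacent G u v \<longleftrightarrow> u \<rightarrow>\<^bsub>G\<^esub> v \<or> v \<rightarrow>\<^bsub>G\<^esub> u"

definition tournament :: "('a, 'b) pre_digraph \<Rightarrow> bool" where
  "tournament G \<longleftrightarrow> oriented_graph G \<and>
     (\<forall>u \<in> verts G. \<forall>v \<in> verts G. u \<noteq> v \<longrightarrow> adjacent G u v)"

definition acyclic_digraph :: "('a, 'b) pre_digraph \<Rightarrow> bool" where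
  "acyclic_digraph G \<longleftrightarrow> \<not> (\<exists>p. pre_digraph.cycle G p)"

definition is_coloring :: "('a, 'b) pre_digraph \<Rightarrow> nat \<Rightarrow> ('a \<Rightarrow> nat) \<Rightarrow> bool" where
  "is_coloring G k c \<longleftrightarrow> c ` verts G \<subseteq> {1..k} \<and>
     (\<forall>i \<in> {1..k}. acyclic_digraph (G \<restriction> {v \<in> verts G. c v = i}))"

definition two_dichromatic :: "('a, 'b) pre_digraph \<Rightarrow> bool" where
  "two_dichromatic G \<longleftrightarrow> (\<exists>c. is_coloring G 2 c)"

text \<open>
  Saturation in the class of all oriented graphs with property \<open>P\<close>.
  Arcs are pairs of vertices here, so that every arc that could be added exists as
  an element of the arc type. In an oriented graph the arcs whose addition gives a new
  oriented graph on the same vertices are those joining distinct non-adjacent vertices.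
\<close>
definition saturated_in ::
  "(('a, 'a \<times> 'a) pre_digraph \<Rightarrow> bool) \<Rightarrow> 'a pair_pre_digraph \<Rightarrow> bool" where
  "saturated_in P D \<longleftrightarrow>
     oriented_graph (with_proj D) \<and> \<not> tournament (with_proj D) \<and> P (with_proj D) \<and>
     (\<forall>u \<in> pverts D. \<forall>v \<in> pverts D. u \<noteq> v \<and> \<not> adjacent (with_proj D) u v \<longrightarrow>
        \<not> P (pre_digraph.add_arc (with_proj D) (u, v)))"

lemma oriented_graph_add_arc_iff:
  assumes "oriented_graph (with_proj D)" "u \<in> pverts D" "v \<in> pverts D" "(u, v) \<notin> parcs D"
  shows "oriented_graph (pre_digraph.add_arc (with_proj D) (u, v)) \<longleftrightarrow>
           u \<noteq> v \<and> \<not> adjacent (with_proj D) u v"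
proof -
  interpret oriented_graph "with_proj D" by fact
  have ends: "arcs_ends (pre_digraph.add_arc (with_proj D) (u, v)) = insert (u, v) (parcs D)"
    by (auto simp: arcs_ends_conv add_arc_def)
  show ?thesis
  proof
    assume "oriented_graph (pre_digraph.add_arc (with_proj D) (u, v))"
    then interpret A: oriented_graph "pre_digraph.add_arc (with_proj D) (u, v)" .
    have "(v, u) \<notin> insert (u, v) (parcs D)"
      using A.no_digons[of u v] by (simp add: ends)
    then show "u \<noteq> v \<and> \<not> adjacent (with_proj D) u v"
      using assms(4) by (auto simp: adjacent_def)
  next
    assume new: "u \<noteq> v \<and> \<not> adjacent (with_proj D) u v"
    show "oriented_graph (pre_digraph.add_arc (with_proj D) (u, v))"
    proof
      fix x y
      assume "(x, y) \<in> arcs_ends (pre_digraph.add_arc (with_proj D) (u, v))"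
      then show "(y, x) \<notin> arcs_ends (pre_digraph.add_arc (with_proj D) (u, v))"
        using new no_digons[of x y] by (auto simp: ends adjacent_def)
    qed (use new assms(2,3) wellformed no_loops finite_verts finite_arcs
         in \<open>auto simp: add_arc_def arc_to_ends_def\<close>)
  qed
qed

end

theory Submission
  imports Defs
begin

text \<open>
  Every colouring of \<open>D\<close> remains a colouring after two given distinct vertices \<open>u\<close> and \<open>v\<close>
  are joined by an arc in a suitable direction. If they have different colours, no colour class
  sees the new arc. If they share a colour, the class is acyclic, so it cannot contain both a
  path from \<open>u\<close> to \<open>v\<close> and one from \<open>v\<close> to \<open>u\<close>; the arc from \<open>u\<close> to \<open>v\<close> closes
  a cycle only in the presence of a path from \<open>v\<close> to \<open>u\<close>, so one direction is harmless
  (lemma \<open>is_coloring_add_arc\<close>). Hence a two-dichromatic oriented graph with a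
  non-adjacent pair always admits another arc, which is what saturation forbids. The argument
  works for any number of colours.
\<close>

text \<open>
  A shortest closed walk is a cycle, so acyclicity can be read off the transitive closure of the
  dominance relation. This gives access to the library's criterion for
  acyclicity of a relation enlarged by one pair.
\<close>
lemma (in wf_digraph) acyclic_digraph_iff: "acyclic_digraph G \<longleftrightarrow> acyclic (arcs_ends G)"
proof
  assume "acyclic_digraph G"
  then show "acyclic (arcs_ends G)"
    using closed_w_imp_cycle
    by (auto simp: acyclic_digraph_def acyclic_def reachable1_awalk closed_w_def)
next
  assume "acyclic (arcs_ends G)"
  then show "acyclic_digraph G"
    by (auto simp: acyclic_digraph_def acyclic_def cycle_def reachable1_awalk)
qed

lemma is_coloring_iff:
  "is_coloring G k c \<longleftrightarrow> c ` verts G \<subseteq> {1..k} \<and>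
     (\<forall>i \<in> {1..k}. acyclic (arcs_ends (G \<restriction> {v \<in> verts G. c v = i})))"
proof -
  have "wf_digraph (G \<restriction> S)" for S
    by unfold_locales auto
  then show ?thesis
    by (simp add: is_coloring_def wf_digraph.acyclic_digraph_iff)
qed

lemma arcs_ends_induce_add_arc:
  assumes "u \<in> pverts D" "v \<in> pverts D"
  shows "arcs_ends (pre_digraph.add_arc (with_proj D) (u, v)
             \<restriction> {w \<in> verts (pre_digraph.add_arc (with_proj D) (u, v)). c w = i}) =
         (if c u = i \<and> c v = i then {(u, v)} else {}) \<union>
           arcs_ends (with_proj D \<restriction> {w \<in> pverts D. c w = i})"
  (is "?L = ?R")
proof -
  have "verts (pre_digraph.add_arc (with_proj D) (u, v)) = pverts D"
    using assms by (auto simp: pre_digraph.add_arc_def)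
  then have "(a, b) \<in> ?L \<longleftrightarrow> (a, b) \<in> ?R" for a b
    using assms
    by (simp add: arcs_ends_conv pre_digraph.add_arc_def induce_subgraph_def) blast
  then show ?thesis
    by (intro set_eqI) (simp only: split_paired_all)
qed

text \<open>
  Both directions could only fail in the common colour class of \<open>u\<close> and \<open>v\<close>, which would then
  contain paths both ways between two distinct vertices.
\<close>
lemma is_coloring_add_arc:
  assumes col: "is_coloring (with_proj D) k c"
    and "u \<in> pverts D" "v \<in> pverts D" "u \<noteq> v"
  shows "is_coloring (pre_digraph.add_arc (with_proj D) (u, v)) k c \<or>
         is_coloring (pre_digraph.add_arc (with_proj D) (v, u)) k c"
proof -
  define R where "R i = arcs_ends (with_proj D \<restriction> {w \<in> pverts D. c w = i})" for i
  have range: "c ` pverts D \<subseteq> {1..k}" and acyc: "\<And>i. i \<in> {1..k} \<Longrightarrow> acyclic (R i)"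
    using col by (auto simp: is_coloring_iff R_def)
  have extend: "is_coloring (pre_digraph.add_arc (with_proj D) (x, y)) k c"
    if "x \<in> pverts D" "y \<in> pverts D" "c x = c y \<Longrightarrow> (y, x) \<notin> (R (c x))\<^sup>*" for x y
  proof -
    have "verts (pre_digraph.add_arc (with_proj D) (x, y)) = pverts D"
      using that by (auto simp: pre_digraph.add_arc_def)
    moreover have "acyclic ((if c x = i \<and> c y = i then {(x, y)} else {}) \<union> R i)"
      if "i \<in> {1..k}" for i
      using acyc[OF that] \<open>c x = c y \<Longrightarrow> (y, x) \<notin> (R (c x))\<^sup>*\<close> by auto
    ultimately show ?thesis
      unfolding is_coloring_iff arcs_ends_induce_add_arc[OF that(1,2)]
      using range by (simp add: R_def)
  qed
  have "(v, u) \<notin> (R (c u))\<^sup>* \<or> (u, v) \<notin> (R (c u))\<^sup>*"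
  proof -
    have "c u \<in> {1..k}"
      using range assms(2) by auto
    then have "antisym ((R (c u))\<^sup>*)"
      by (intro acyclic_impl_antisym_rtrancl acyc)
    then show ?thesis
      using assms(4) by (auto dest: antisymD)
  qed
  then show ?thesis
    using extend[of u v] extend[of v u] assms(2,3) by metis
qed

theorem mainTheorem5:
  shows "\<not> (\<exists>D :: 'a pair_pre_digraph. saturated_in two_dichromatic D)"
proof
  assume "\<exists>D :: 'a pair_pre_digraph. saturated_in two_dichromatic D"
  then obtain D :: "'a pair_pre_digraph" where sat: "saturated_in two_dichromatic D" ..
  then obtain u v where uv: "u \<in> pverts D" "v \<in> pverts D" "u \<noteq> v"
    "\<not> adjacent (with_proj D) u v"
    by (auto simp: saturated_in_def tournament_def)
  then have "\<not> adjacent (with_proj D) v u"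
    by (auto simp: adjacent_def)
  with sat uv have "\<not> two_dichromatic (pre_digraph.add_arc (with_proj D) (u, v))"
    "\<not> two_dichromatic (pre_digraph.add_arc (with_proj D) (v, u))"
    by (simp_all add: saturated_in_def)
  moreover obtain c where "is_coloring (with_proj D) 2 c"
    using sat by (auto simp: saturated_in_def two_dichromatic_def)
  ultimately show False
    using is_coloring_add_arc[OF _ uv(1-3)] by (auto simp: two_dichromatic_def)
qed

end
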